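(* Let $f:\mathbb{C}\to\mathbb{C}$ be a transcendental entire function. Then its Julia set $\mathcal{J}_f$ is perfect.
   Context: A transcendental entire function is an entire function $\mathbb{C}\to\mathbb{C}$ that is not a polynomial. For $n\ge 1$, $f^{\circ n}$ denotes the $n$-th iterate of $f$ (so $f^{\circ 2}=f\circ f$). The Fatou set $\mathcal{F}_f\subset\mathbb{C}$ of $f$ is the set of points of $\mathbb{C}$ having a neighbourhood on which the iterates $\{f^{\circ n}\}_{n\ge 1}$ form a normal family of holomorphic functions. Normality is in the usual sense of Montel: every sequence in the family has a subsequence converging uniformly on compact subsets with respect to the spherical metric, the limit being allowed to be identically $\infty$. The Julia set is the complement $\mathcal{J}_f:=\mathbb{C}\setminus\mathcal{F}_f$. A subset of $\mathbb{C}$ is perfect if it is closed in $\mathbb{C}$ and has no isolated points. *)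

theory Defs
  imports "HOL-Complex_Analysis.Complex_Analysis"
begin

definition transcendental_entire :: "(complex \<Rightarrow> complex) \<Rightarrow> bool" where
  "transcendental_entire f \<longleftrightarrow> f holomorphic_on UNIV \<and> \<not> (\<exists>p :: complex poly. f = poly p)"

text \<open>In the Riemann sphere, \<open>None\<close> is the point at infinity.\<close>

type_synonym riemann_sphere = "complex option"

text \<open>Inverse of the stereographic projection from the north pole \<open>(0, 1)\<close> of the unit sphere
  of \<open>\<complex> \<times> \<real>\<close>.\<close>

fun stereographic :: "riemann_sphere \<Rightarrow> complex \<times> real" where
  "stereographic None = (0, 1)"
| "stereographic (Some z) =
     ((2 / (1 + (cmod z)\<^sup>2)) *\<^sub>R z, ((cmod z)\<^sup>2 - 1) / ((cmod z)\<^sup>2 + 1))"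

lemma norm_stereographic [simp]: "norm (stereographic p) = 1"
proof (cases p)
  case None
  then show ?thesis by simp
next
  case (Some z)
  define r where "r = (cmod z)\<^sup>2"
  have r: "r \<ge> 0" "1 + r > 0"
    by (simp_all add: r_def add_pos_nonneg)
  have "(norm (stereographic p))\<^sup>2 = (2 / (1 + r))\<^sup>2 * r + ((r - 1) / (r + 1))\<^sup>2"
    using r by (simp add: Some norm_Pair power_mult_distrib power_divide flip: r_def)
  also have "\<dots> = (4 * r + (r - 1)\<^sup>2) / (1 + r)\<^sup>2"
    by (simp add: power_divide add_divide_distrib add.commute)
  also have "4 * r + (r - 1)\<^sup>2 = (1 + r)\<^sup>2"
    by (simp add: power2_eq_square algebra_simps)
  finally have "(norm (stereographic p))\<^sup>2 = 1\<^sup>2"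
    using r by simp
  then show ?thesis
    by (metis norm_ge_zero power2_eq_imp_eq zero_le_one)
qed

text \<open>The spherical metric is the great-circle distance on the unit sphere. (The chordal distance
  induces the same uniform structure.)\<close>

definition spherical_dist :: "riemann_sphere \<Rightarrow> riemann_sphere \<Rightarrow> real" where
  "spherical_dist p q = arccos (stereographic p \<bullet> stereographic q)"

definition spherical_uniform_limit ::
    "complex set \<Rightarrow> (nat \<Rightarrow> complex \<Rightarrow> complex) \<Rightarrow> (complex \<Rightarrow> riemann_sphere) \<Rightarrow> bool" where
  "spherical_uniform_limit K s g \<longleftrightarrow>
     (\<forall>e>0. \<forall>\<^sub>F k in sequentially. \<forall>z\<in>K. spherical_dist (Some (s k z)) (g z) < e)"

text \<open>The limit \<open>g\<close> may take the value infinity, in particular identically.\<close>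

definition normal_on :: "complex set \<Rightarrow> (complex \<Rightarrow> complex) set \<Rightarrow> bool" where
  "normal_on U F \<longleftrightarrow>
     (\<forall>h\<in>F. h holomorphic_on U) \<and>
     (\<forall>s :: nat \<Rightarrow> complex \<Rightarrow> complex. range s \<subseteq> F \<longrightarrow>
        (\<exists>(r :: nat \<Rightarrow> nat) g. strict_mono r \<and>
           (\<forall>K. compact K \<and> K \<subseteq> U \<longrightarrow> spherical_uniform_limit K (s \<circ> r) g)))"

definition Fatou_set :: "(complex \<Rightarrow> complex) \<Rightarrow> complex set" where
  "Fatou_set f = {z. \<exists>U. open U \<and> z \<in> U \<and> normal_on U {f ^^ n | n. n \<ge> 1}}"

definition Julia_set :: "(complex \<Rightarrow> complex) \<Rightarrow> complex set" where
  "Julia_set f = - Fatou_set f"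

definition perfect :: "complex set \<Rightarrow> bool" where
  "perfect S \<longleftrightarrow> closed S \<and> \<not> (\<exists>z. z isolated_in S)"

end

theory Submission
  imports Defs
begin

text \<open>Let \<open>z\<close> be an isolated point of the Julia set \<open>J\<close>. Near \<open>z\<close> the iterates omit every point of \<open>J\<close>
  outside the forward orbit of \<open>z\<close>, because \<open>J\<close> is backward invariant; by Montel there is at most
  one such point. Hence every point of \<open>J\<close> has only finitely many preimages, and the great Picard
  theorem leaves only \<open>J = {z}\<close>, with no preimage of \<open>z\<close> other than possibly \<open>z\<close> itself. Picard,
  applied to \<open>(f w - z) / (w - z)\<close>, which does not vanish for \<open>w \<noteq> z\<close>, now yields a fixed point
  \<open>p \<noteq> z\<close>. Its orbit is bounded, so by normality the iterates are locally bounded off \<open>z\<close>, and by the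
  maximum principle near \<open>z\<close> too, which puts \<open>z\<close> into the Fatou set.\<close>

section \<open>The spherical metric and normal families\<close>

lemma dist_stereographic:
  "(dist (stereographic p) (stereographic q))\<^sup>2 = 2 - 2 * (stereographic p \<bullet> stereographic q)"
proof -
  have *: "stereographic p \<bullet> stereographic p = 1" "stereographic q \<bullet> stereographic q = 1"
    using norm_stereographic by (metis norm_eq_1)+
  show ?thesis
    unfolding dist_norm power2_norm_eq_inner
    by (simp add: inner_diff_left inner_diff_right * inner_commute)
qed

text \<open>On the unit sphere an arc of length \<open>e\<close> has a chord of length
  \<open>2 * sin (e / 2)\<close>, and up to arcs of length pi the chord grows with the arc.\<close>

lemma spherical_dist_less_iff:
  assumes "0 < e" "e \<le> pi"
  shows "spherical_dist p q < e \<longleftrightarrow> dist (stereographic p) (stereographic q) < 2 * sin (e / 2)"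
proof -
  let ?t = "stereographic p \<bullet> stereographic q" and ?d = "dist (stereographic p) (stereographic q)"
  have t: "\<bar>?t\<bar> \<le> 1"
    using Cauchy_Schwarz_ineq2[of "stereographic p" "stereographic q"] by simp
  have "spherical_dist p q < e \<longleftrightarrow> cos e < ?t"
    unfolding spherical_dist_def using assms t arccos_less_mono[of ?t "cos e"] arccos_cos[of e]
    by simp
  also have "\<dots> \<longleftrightarrow> ?d\<^sup>2 < (2 * sin (e / 2))\<^sup>2"
    using cos_double_sin[of "e / 2"] by (auto simp: dist_stereographic power_mult_distrib)
  also have "\<dots> \<longleftrightarrow> ?d < 2 * sin (e / 2)"
  proof -
    have "sin (e / 2) > 0" using assms by (intro sin_gt_zero) auto
    then show ?thesis
      by (smt (verit) power_less_imp_less_base power_strict_mono zero_le_dist zero_less_numeral)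
  qed
  finally show ?thesis .
qed

text \<open>Small arcs and small chords control each other, so spherical convergence becomes
  ordinary uniform convergence in \<open>complex \<times> real\<close>, to which the general theory
  of uniform limits applies.\<close>

lemma spherical_uniform_limit_iff:
  "spherical_uniform_limit K s g \<longleftrightarrow>
     uniform_limit K (\<lambda>k z. stereographic (Some (s k z))) (\<lambda>z. stereographic (g z)) sequentially"
proof
  assume L: "spherical_uniform_limit K s g"
  show "uniform_limit K (\<lambda>k z. stereographic (Some (s k z))) (\<lambda>z. stereographic (g z)) sequentially"
  proof (rule uniform_limitI)
    fix d :: real assume "d > 0"
    \<comment> \<open>Cutting off at pi keeps \<open>e\<close> in the range where arcs and chords
      can be compared.\<close>
    define e where "e = min d pi"
    have e: "0 < e" "e \<le> pi" "e \<le> d" using \<open>d > 0\<close> by (auto simp: e_def)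
    have "2 * sin (e / 2) \<le> d" using sin_x_le_x[of "e / 2"] e by auto
    moreover have "\<forall>\<^sub>F k in sequentially. \<forall>z\<in>K. spherical_dist (Some (s k z)) (g z) < e"
      using L e unfolding spherical_uniform_limit_def by blast
    ultimately show "\<forall>\<^sub>F k in sequentially. \<forall>z\<in>K. dist (stereographic (Some (s k z))) (stereographic (g z)) < d"
      by (elim eventually_mono) (use spherical_dist_less_iff[OF e(1,2)] in force)
  qed
next
  assume L: "uniform_limit K (\<lambda>k z. stereographic (Some (s k z))) (\<lambda>z. stereographic (g z)) sequentially"
  show "spherical_uniform_limit K s g"
    unfolding spherical_uniform_limit_def
  proof (intro allI impI)
    fix d :: real assume "d > 0"
    define e where "e = min d pi"
    have e: "0 < e" "e \<le> pi" "e \<le> d" using \<open>d > 0\<close> by (auto simp: e_def)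
    have "sin (e / 2) > 0" using e by (intro sin_gt_zero) auto
    then have "\<forall>\<^sub>F k in sequentially. \<forall>z\<in>K. dist (stereographic (Some (s k z))) (stereographic (g z)) < 2 * sin (e / 2)"
      using L by (intro uniform_limitD) auto
    then show "\<forall>\<^sub>F k in sequentially. \<forall>z\<in>K. spherical_dist (Some (s k z)) (g z) < d"
      by (elim eventually_mono) (use spherical_dist_less_iff[OF e(1,2)] e(3) less_le_trans in blast)
  qed
qed

text \<open>The stereographic image of the point with homogeneous coordinates \<open>[p : q]\<close>, which is
  continuous also where \<open>q\<close> vanishes.\<close>

definition hstereo :: "complex \<Rightarrow> complex \<Rightarrow> complex \<times> real" where
  "hstereo p q = ((2 / ((cmod p)\<^sup>2 + (cmod q)\<^sup>2)) *\<^sub>R (p * cnj q),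
     ((cmod p)\<^sup>2 - (cmod q)\<^sup>2) / ((cmod p)\<^sup>2 + (cmod q)\<^sup>2))"

lemma hstereo_infinity: "p \<noteq> 0 \<Longrightarrow> hstereo p 0 = stereographic None"
  by (simp add: hstereo_def)

lemma hstereo_finite:
  assumes "q \<noteq> 0"
  shows "hstereo p q = stereographic (Some (p / q))"
proof -
  have q: "(cmod q)\<^sup>2 > 0" using assms by simp
  have s: "(cmod p)\<^sup>2 + (cmod q)\<^sup>2 > 0" using q by (simp add: add_nonneg_pos)
  have c: "p / q = (1 / (cmod q)\<^sup>2) *\<^sub>R (p * cnj q)"
    by (subst complex_div_cnj) (simp add: scaleR_conv_of_real)
  have "1 + (cmod (p / q))\<^sup>2 = ((cmod p)\<^sup>2 + (cmod q)\<^sup>2) / (cmod q)\<^sup>2"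
    using q by (simp add: norm_divide power_divide add_divide_distrib)
  then have 1: "(2 / (1 + (cmod (p / q))\<^sup>2)) *\<^sub>R (p / q)
      = (2 / ((cmod p)\<^sup>2 + (cmod q)\<^sup>2)) *\<^sub>R (p * cnj q)"
    unfolding c using q s by simp
  have 2: "((cmod (p / q))\<^sup>2 - 1) / ((cmod (p / q))\<^sup>2 + 1)
      = ((cmod p)\<^sup>2 - (cmod q)\<^sup>2) / ((cmod p)\<^sup>2 + (cmod q)\<^sup>2)"
    using q s by (simp add: norm_divide power_divide divide_simps)
  show ?thesis by (simp add: hstereo_def 1 2 del: of_real_divide)
qed

lemma continuous_on_hstereo:
  assumes "continuous_on S p" "continuous_on S q" "\<And>u. u \<in> S \<Longrightarrow> p u \<noteq> 0 \<or> q u \<noteq> 0"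
  shows "continuous_on S (\<lambda>u. hstereo (p u) (q u))"
proof -
  have "(cmod (p u))\<^sup>2 + (cmod (q u))\<^sup>2 \<noteq> 0" if "u \<in> S" for u
    using assms(3)[OF that] by (simp add: sum_power2_eq_zero_iff)
  then show ?thesis
    unfolding hstereo_def by (intro continuous_intros assms) auto
qed

lemma continuous_on_stereographic_Some: "continuous_on S (\<lambda>z. stereographic (Some z))"
  using continuous_on_hstereo[of S "\<lambda>z. z" "\<lambda>_. 1"] by (simp add: hstereo_finite)

section \<open>Criteria for normality\<close>

text \<open>Montel's theorem for locally bounded sequences gives a subsequence converging in the
  plane. On a compact set all values lie in one closed disc, where \<tau> is uniformly continuous,
  so convergence survives composition with \<tau>. Choosing for \<tau> a map into the sphere then
  yields spherical convergence.\<close>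

lemma bounded_subsequence_compose:
  fixes u :: "nat \<Rightarrow> complex \<Rightarrow> complex" and \<tau> :: "complex \<Rightarrow> 'b::metric_space"
  assumes "open S" and hol: "\<And>k. u k holomorphic_on S"
    and bd: "\<And>K. compact K \<Longrightarrow> K \<subseteq> S \<Longrightarrow> \<exists>B. \<forall>k. \<forall>z\<in>K. cmod (u k z) \<le> B"
    and \<tau>: "continuous_on UNIV \<tau>"
  shows "\<exists>(r::nat \<Rightarrow> nat) \<psi>. strict_mono r \<and> 
    (\<forall>K. compact K \<and> K \<subseteq> S \<longrightarrow> uniform_limit K (\<lambda>k z. \<tau> (u (r k) z)) (\<lambda>z. \<tau> (\<psi> z)) sequentially)"
proof -
  obtain \<psi> r where r: "strict_mono (r :: nat \<Rightarrow> nat)" 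
    and lim: "\<And>K. \<lbrakk>compact K; K \<subseteq> S\<rbrakk> \<Longrightarrow> uniform_limit K (u \<circ> r) \<psi> sequentially"
    using Montel[of S "range u" u] assms(1) hol bd by (smt (verit) imageE order_refl rangeI image_iff)
  have "uniform_limit K (\<lambda>k z. \<tau> (u (r k) z)) (\<lambda>z. \<tau> (\<psi> z)) sequentially"
    if K: "compact K" "K \<subseteq> S" for K
  proof -
    obtain B where B: "\<And>k z. z \<in> K \<Longrightarrow> cmod (u k z) \<le> B" using bd[OF K] by blast
    have "uniformly_continuous_on (cball 0 B) \<tau>"
      by (intro compact_uniformly_continuous continuous_on_subset[OF \<tau>]) auto
    moreover have "uniform_limit K (\<lambda>k z. u (r k) z) \<psi> sequentially"
      using lim[OF K] by (simp add: comp_def)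
    ultimately show ?thesis
      using uniform_limit_compose_uniformly_continuous_on[where g = "\<lambda>k. u (r k)" and B = "cball 0 B" and f = \<tau>] B
      by simp
  qed
  then show ?thesis using r by blast
qed

text \<open>Montel's fundamental normality test. An affine change moves the omitted values to 0 and
  1. At a base point \<open>w\<close>, infinitely many members of a sequence have modulus at most 1,
  or infinitely many reciprocals do; reciprocals omit 0 and 1 as well. Either subsequence is locally
  bounded by \<open>GPicard3\<close>, a consequence of Schottky's theorem.\<close>

lemma normal_on_omitting_two_values:
  assumes "a \<noteq> b" and "open S" "connected S"
    and hol: "\<And>h. h \<in> F \<Longrightarrow> h holomorphic_on S"
    and omit: "\<And>h z. h \<in> F \<Longrightarrow> z \<in> S \<Longrightarrow> h z \<noteq> a \<and> h z \<noteq> b"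
  shows "normal_on S F"
  unfolding normal_on_def
proof (intro conjI ballI allI impI)
  fix s :: "nat \<Rightarrow> complex \<Rightarrow> complex" assume s: "range s \<subseteq> F"
  show "\<exists>(r :: nat \<Rightarrow> nat) g. strict_mono r \<and>
           (\<forall>K. compact K \<and> K \<subseteq> S \<longrightarrow> spherical_uniform_limit K (s \<circ> r) g)"
  proof (cases "S = {}")
    case True
    then show ?thesis
      by (intro exI[of _ id] exI[of _ "\<lambda>_. None"]) (auto simp: strict_mono_def spherical_uniform_limit_def)
  next
    case False
    then obtain w where w: "w \<in> S" by blast
    define h where "h k z = (s k z - a) / (b - a)" for k z
    have s_eq: "s k z = a + (b - a) * h k z" for k z
      using \<open>a \<noteq> b\<close> by (simp add: h_def)
    have h_hol: "h k holomorphic_on S" for k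
      unfolding h_def[abs_def] using hol s \<open>a \<noteq> b\<close> by (intro holomorphic_intros) auto
    have h01: "h k z \<noteq> 0 \<and> h k z \<noteq> 1" if "z \<in> S" for k z
      using omit[of "s k" z] s that \<open>a \<noteq> b\<close> by (auto simp: h_def)
    define A where "A = {k. cmod (h k w) \<le> 1}"
    have bound: "\<exists>B. \<forall>u\<in>Y. \<forall>z\<in>K. cmod (u z) \<le> B"
      if "compact K" "K \<subseteq> S" "\<And>u. u \<in> Y \<Longrightarrow> u holomorphic_on S"
        "\<And>u z. u \<in> Y \<Longrightarrow> z \<in> S \<Longrightarrow> u z \<noteq> 0 \<and> u z \<noteq> 1" "\<And>u. u \<in> Y \<Longrightarrow> cmod (u w) \<le> 1" for Y K
      by (rule GPicard3[of S w Y Y K]) (use assms w that in auto)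
    show ?thesis
    proof (cases "infinite A")
      case True
      define m where "m = enumerate A"
      have m: "strict_mono m" "\<And>k. m k \<in> A"
        using True by (simp_all add: m_def strict_mono_enumerate enumerate_in_set)
      define \<tau> where "\<tau> v = hstereo (a + (b - a) * v) 1" for v
      have "\<exists>(r::nat \<Rightarrow> nat) \<psi>. strict_mono r \<and> 
          (\<forall>K. compact K \<and> K \<subseteq> S \<longrightarrow> uniform_limit K (\<lambda>k z. \<tau> (h (m (r k)) z)) (\<lambda>z. \<tau> (\<psi> z)) sequentially)"
      proof (rule bounded_subsequence_compose[OF \<open>open S\<close> h_hol])
        show "continuous_on UNIV \<tau>"
          unfolding \<tau>_def by (intro continuous_on_hstereo continuous_intros) auto
        show "\<exists>B. \<forall>k. \<forall>z\<in>K. cmod (h (m k) z) \<le> B" if K: "compact K" "K \<subseteq> S" for K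
        proof -
          have "\<exists>B. \<forall>u\<in>range (\<lambda>k. h (m k)). \<forall>z\<in>K. cmod (u z) \<le> B"
            by (rule bound[OF K]) (use h_hol h01 m in \<open>auto simp: A_def\<close>)
          then show ?thesis by auto
        qed
      qed
      then obtain r :: "nat \<Rightarrow> nat" and \<psi> where r: "strict_mono r"
        and lim: "\<And>K. compact K \<and> K \<subseteq> S \<Longrightarrow> uniform_limit K (\<lambda>k z. \<tau> (h (m (r k)) z)) (\<lambda>z. \<tau> (\<psi> z)) sequentially"
        by blast
      have "strict_mono (m \<circ> r)" using m r by (simp add: strict_mono_o)
      moreover have "spherical_uniform_limit K (s \<circ> (m \<circ> r)) (\<lambda>z. Some (a + (b - a) * \<psi> z))"
        if "compact K \<and> K \<subseteq> S" for K
        using lim[OF that] unfolding spherical_uniform_limit_iff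
        by (simp add: \<tau>_def hstereo_finite s_eq del: stereographic.simps)
      ultimately show ?thesis by blast
    next
      case False
      then have True: "infinite (- A)" by simp
      define m where "m = enumerate (- A)"
      have m: "strict_mono m" "\<And>k. m k \<notin> A"
        using strict_mono_enumerate[OF True] enumerate_in_set[OF True] by (auto simp: m_def)
      \<comment> \<open>For \<open>v\<close> the reciprocal of \<open>h\<close>, the original value
        \<open>a + (b - a) / v\<close> has homogeneous coordinates
        \<open>[a * v + (b - a) : v]\<close>. They never vanish together, so \<tau> is continuous
        also at \<open>v = 0\<close>, which it sends to infinity.\<close>
      define \<tau> where "\<tau> v = hstereo (a * v + (b - a)) v" for v
      have "\<exists>(r::nat \<Rightarrow> nat) \<psi>. strict_mono r \<and> 
          (\<forall>K. compact K \<and> K \<subseteq> S \<longrightarrow> uniform_limit K (\<lambda>k z. \<tau> (inverse (h (m (r k)) z))) (\<lambda>z. \<tau> (\<psi> z)) sequentially)"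
      proof (rule bounded_subsequence_compose[where u = "\<lambda>k z. inverse (h (m k) z)", OF \<open>open S\<close>])
        show "(\<lambda>z. inverse (h (m k) z)) holomorphic_on S" for k
          using h_hol h01 by (intro holomorphic_intros) auto
        show "continuous_on UNIV \<tau>"
          unfolding \<tau>_def using \<open>a \<noteq> b\<close> by (intro continuous_on_hstereo continuous_intros) auto
        show "\<exists>B. \<forall>k. \<forall>z\<in>K. cmod (inverse (h (m k) z)) \<le> B" if K: "compact K" "K \<subseteq> S" for K
        proof -
          have "\<exists>B. \<forall>u\<in>range (\<lambda>k z. inverse (h (m k) z)). \<forall>z\<in>K. cmod (u z) \<le> B"
          proof (rule bound[OF K])
            fix u assume "u \<in> range (\<lambda>k z. inverse (h (m k) z))"
            then obtain k where u: "u = (\<lambda>z. inverse (h (m k) z))" by blast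
            show "u holomorphic_on S" unfolding u
              using h_hol h01 by (intro holomorphic_intros) auto
            show "u z \<noteq> 0 \<and> u z \<noteq> 1" if "z \<in> S" for z
              unfolding u using h01[OF that, of "m k"] by (simp add: inverse_eq_1_iff)
            have "cmod (h (m k) w) > 1" using m(2)[of k] by (simp add: A_def)
            then show "cmod (u w) \<le> 1" unfolding u
              by (metis inverse_le_1_iff less_imp_le norm_inverse)
          qed
          then show ?thesis by auto
        qed
      qed
      then obtain r :: "nat \<Rightarrow> nat" and \<psi> where r: "strict_mono r"
        and lim: "\<And>K. compact K \<and> K \<subseteq> S \<Longrightarrow> uniform_limit K (\<lambda>k z. \<tau> (inverse (h (m (r k)) z))) (\<lambda>z. \<tau> (\<psi> z)) sequentially"
        by blast
      define g where "g z = (if \<psi> z = 0 then None else Some (a + (b - a) / \<psi> z))" for z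
      have g: "\<tau> (\<psi> z) = stereographic (g z)" for z
        using \<open>a \<noteq> b\<close>
        by (auto simp: \<tau>_def g_def hstereo_finite hstereo_infinity add_divide_distrib 
            simp del: stereographic.simps)
      have "strict_mono (m \<circ> r)" using m r by (simp add: strict_mono_o)
      moreover have "spherical_uniform_limit K (s \<circ> (m \<circ> r)) g"
        if K: "compact K \<and> K \<subseteq> S" for K
      proof -
        have "\<tau> (inverse (h k z)) = stereographic (Some (s k z))" if "z \<in> K" for k z
        proof -
          have nz: "h k z \<noteq> 0" using h01 K that by blast
          then have "(a * inverse (h k z) + (b - a)) / inverse (h k z) = s k z"
            by (simp add: s_eq field_simps)
          then show ?thesis using nz by (simp add: \<tau>_def hstereo_finite del: stereographic.simps)
        qed
        then show ?thesis
          using lim[OF K] unfolding spherical_uniform_limit_iff g comp_def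
          unfolding uniform_limit_iff by simp
      qed
      ultimately show ?thesis by blast
    qed
  qed
qed (use hol in auto)

text \<open>The case of Montel's theorem in which all limits are finite; it serves at the end to put
  the isolated point into the Fatou set.\<close>

lemma normal_on_bounded:
  assumes "open S" and hol: "\<And>h. h \<in> F \<Longrightarrow> h holomorphic_on S"
    and bd: "\<And>h z. h \<in> F \<Longrightarrow> z \<in> S \<Longrightarrow> cmod (h z) \<le> B"
  shows "normal_on S F"
  unfolding normal_on_def
proof (intro conjI ballI allI impI)
  fix s :: "nat \<Rightarrow> complex \<Rightarrow> complex" assume s: "range s \<subseteq> F"
  have "\<exists>(r::nat \<Rightarrow> nat) \<psi>. strict_mono r \<and> 
      (\<forall>K. compact K \<and> K \<subseteq> S \<longrightarrow> uniform_limit K (\<lambda>k z. stereographic (Some (s (r k) z)))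
         (\<lambda>z. stereographic (Some (\<psi> z))) sequentially)"
  proof (rule bounded_subsequence_compose[OF \<open>open S\<close> _ _ continuous_on_stereographic_Some])
    show "s k holomorphic_on S" for k using s hol by auto
    show "\<exists>B. \<forall>k. \<forall>z\<in>K. cmod (s k z) \<le> B" if "K \<subseteq> S" for K
      using that s bd by (metis range_subsetD subsetD)
  qed
  then obtain r :: "nat \<Rightarrow> nat" and \<psi> where "strict_mono r" "\<And>K. compact K \<and> K \<subseteq> S \<Longrightarrow>
      uniform_limit K (\<lambda>k z. stereographic (Some (s (r k) z))) (\<lambda>z. stereographic (Some (\<psi> z))) sequentially"
    by blast
  then show "\<exists>(r :: nat \<Rightarrow> nat) g. strict_mono r \<and>
      (\<forall>K. compact K \<and> K \<subseteq> S \<longrightarrow> spherical_uniform_limit K (s \<circ> r) g)"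
    unfolding spherical_uniform_limit_iff comp_def
    by (intro exI[of _ r] exI[of _ "\<lambda>z. Some (\<psi> z)"]) auto
qed (use hol in auto)

section \<open>Consequences of normality\<close>

text \<open>Otherwise some members \<open>s k\<close> vary by at least \<open>e\<close> between
  \<open>z\<close> and points \<open>x k\<close> tending to \<open>z\<close>. A subsequence
  converges uniformly on the sphere near \<open>z\<close>, its limit is therefore continuous, and
  this contradicts the variation.\<close>

lemma normal_on_equicontinuous:
  assumes normal: "normal_on U F" and "open U" "z \<in> U" "e > 0"
  obtains d where "d > 0" "ball z d \<subseteq> U"
    "\<And>h x. h \<in> F \<Longrightarrow> x \<in> ball z d \<Longrightarrow>
       dist (stereographic (Some (h x))) (stereographic (Some (h z))) < e"
proof -
  let ?\<sigma> = "\<lambda>w. stereographic (Some w)"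
  obtain \<rho> where \<rho>: "\<rho> > 0" "cball z \<rho> \<subseteq> U"
    using \<open>open U\<close> \<open>z \<in> U\<close> open_contains_cball by blast
  have "\<exists>d>0. d \<le> \<rho> \<and> (\<forall>h\<in>F. \<forall>x\<in>ball z d. dist (?\<sigma> (h x)) (?\<sigma> (h z)) < e)"
  proof (rule ccontr)
    assume neg: "\<not> ?thesis"
    have "\<exists>h x. h \<in> F \<and> x \<in> ball z (\<rho> / real (Suc k)) \<and> \<not> dist (?\<sigma> (h x)) (?\<sigma> (h z)) < e" for k
    proof -
      have "\<rho> / real (Suc k) > 0" "\<rho> / real (Suc k) \<le> \<rho>"
        using \<rho> by (auto simp: divide_le_eq mult_le_cancel_left1)
      then show ?thesis using neg by blast
    qed
    then obtain s x where s: "\<And>k. s k \<in> F" and x: "\<And>k. x k \<in> ball z (\<rho> / real (Suc k))"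
      and far: "\<And>k. \<not> dist (?\<sigma> (s k (x k))) (?\<sigma> (s k z)) < e"
      by metis
    have "range s \<subseteq> F" using s by auto
    then obtain r :: "nat \<Rightarrow> nat" and g where r: "strict_mono r"
      and "spherical_uniform_limit (cball z \<rho>) (s \<circ> r) g"
      using normal \<rho> unfolding normal_on_def by (metis compact_cball)
    then have lim: "uniform_limit (cball z \<rho>) (\<lambda>k y. ?\<sigma> (s (r k) y)) (\<lambda>y. stereographic (g y)) sequentially"
      by (simp add: spherical_uniform_limit_iff comp_def)
    have "continuous_on (cball z \<rho>) (\<lambda>y. ?\<sigma> (s (r k) y))" for k
    proof -
      have "s (r k) holomorphic_on U" using s normal by (auto simp: normal_on_def)
      then have "continuous_on (cball z \<rho>) (s (r k))"
        using \<rho> holomorphic_on_imp_continuous_on holomorphic_on_subset by blast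
      then show ?thesis
        by (rule continuous_on_compose2[OF continuous_on_stereographic_Some[of UNIV]]) auto
    qed
    then have "continuous_on (cball z \<rho>) (\<lambda>y. stereographic (g y))"
      using uniform_limit_theorem[OF _ lim] by simp
    then obtain \<delta> where \<delta>: "\<delta> > 0"
      "\<And>y. y \<in> cball z \<rho> \<Longrightarrow> dist y z < \<delta> \<Longrightarrow> dist (stereographic (g y)) (stereographic (g z)) < e / 3"
      using \<open>e > 0\<close> \<rho> unfolding continuous_on_iff
      by (metis centre_in_cball less_imp_le zero_less_divide_iff zero_less_numeral)
    have "\<forall>\<^sub>F k in sequentially. \<forall>y\<in>cball z \<rho>. dist (?\<sigma> (s (r k) y)) (stereographic (g y)) < e / 3"
      using \<open>e > 0\<close> by (intro uniform_limitD[OF lim]) auto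
    moreover have "(\<lambda>k. \<rho> / real (Suc k)) \<longlonglongrightarrow> 0"
      using tendsto_mult_right_zero[OF LIMSEQ_inverse_real_of_nat, of \<rho>] by (simp add: divide_inverse)
    then have "\<forall>\<^sub>F k in sequentially. \<rho> / real (Suc (r k)) < \<delta>"
      using order_tendstoD(2)[OF LIMSEQ_subseq_LIMSEQ[OF _ r]] \<delta>(1) by (auto simp: comp_def)
    ultimately have "\<forall>\<^sub>F k in sequentially. False"
    proof eventually_elim
      case (elim k)
      have "\<rho> / real (Suc (r k)) \<le> \<rho>"
        using \<rho> by (auto simp: divide_le_eq mult_le_cancel_left1)
      then have xk: "x (r k) \<in> cball z \<rho>" "dist (x (r k)) z < \<delta>"
        using x[of "r k"] elim by (auto simp: dist_commute)
      \<comment> \<open>Passing through \<open>g (x (r k))\<close> and \<open>g z\<close>, uniform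
        convergence bounds the outer two distances and continuity of the limit the middle
        one.\<close>
      have "dist (?\<sigma> (s (r k) (x (r k)))) (?\<sigma> (s (r k) z)) < e"
        using elim(1)[THEN bspec, OF xk(1)] elim(1)[THEN bspec, of z] \<delta>(2)[OF xk] \<rho>(1)
        by (intro dist_triangle_third[of _ "stereographic (g (x (r k)))" e "stereographic (g z)"])
          (auto simp: dist_commute simp del: stereographic.simps)
      then show False using far by blast
    qed
    then show False by simp
  qed
  then obtain d where "d > 0" "d \<le> \<rho>" "\<forall>h\<in>F. \<forall>x\<in>ball z d. dist (?\<sigma> (h x)) (?\<sigma> (h z)) < e"
    by blast
  then show ?thesis
    using that \<rho>(2) by (meson ball_subset_cball order.trans subset_ball)
qed

text \<open>The map \<open>w \<mapsto> a + \<rho> * w\<close> carries Schottky's theorem from the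
  unit disc to an arbitrary closed disc.\<close>

lemma Schottky_cball:
  assumes hol: "f holomorphic_on cball a \<rho>" and "\<rho> > 0" and fa: "cmod (f a) \<le> r"
    and omit: "\<And>z. z \<in> cball a \<rho> \<Longrightarrow> f z \<noteq> 0 \<and> f z \<noteq> 1"
    and "0 < t" "t < 1" "cmod (z - a) \<le> t * \<rho>"
  shows "cmod (f z) \<le> exp (pi * exp (pi * (2 + 2 * r + 12 * t / (1 - t))))"
proof -
  have img: "a + of_real \<rho> * w \<in> cball a \<rho>" if "w \<in> cball 0 1" for w
    using that \<open>\<rho> > 0\<close> by (simp add: dist_norm norm_mult)
  have "(f \<circ> (\<lambda>w. a + of_real \<rho> * w)) holomorphic_on cball 0 1"
    by (intro holomorphic_on_compose holomorphic_intros holomorphic_on_subset[OF hol])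
      (use img in auto)
  moreover have "cmod (of_real (inverse \<rho>) * (z - a)) \<le> t"
    using assms by (simp add: norm_mult norm_divide field_simps)
  ultimately have "cmod ((f \<circ> (\<lambda>w. a + of_real \<rho> * w)) (of_real (inverse \<rho>) * (z - a)))
      \<le> exp (pi * exp (pi * (2 + 2 * r + 12 * t / (1 - t))))"
    using Schottky[of "f \<circ> (\<lambda>w. a + of_real \<rho> * w)" r t] fa omit img \<open>0 < t\<close> \<open>t < 1\<close> by auto
  then show ?thesis using \<open>\<rho> > 0\<close> by (simp add: field_simps)
qed

text \<open>Members of the family have small spherical oscillation near \<open>z\<close>, so each is either bounded
  by 3 there or omits 0 and 1 there; Schottky's theorem covers the second case.\<close>

lemma normal_on_bounded_at_imp_bounded_near:
  assumes normal: "normal_on U F" and "open U" "z \<in> U"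
  obtains d where "d > 0"
    "\<And>a M. a \<in> ball z d \<Longrightarrow>
       \<exists>B. \<forall>h\<in>F. cmod (h a) \<le> M \<longrightarrow> (\<forall>x\<in>ball z d. cmod (h x) \<le> B)"
proof -
  let ?\<sigma> = "\<lambda>w. stereographic (Some w)"
  obtain d where d: "d > 0" "ball z d \<subseteq> U"
    and osc: "\<And>h x. h \<in> F \<Longrightarrow> x \<in> ball z d \<Longrightarrow> dist (?\<sigma> (h x)) (?\<sigma> (h z)) < 1/10"
    using normal_on_equicontinuous[OF assms, of "1/10"] by auto
  have height: "snd (?\<sigma> w) = 1 - 2 / ((cmod w)\<^sup>2 + 1)" for w
  proof -
    have "(cmod w)\<^sup>2 + 1 > 0" by (simp add: add_nonneg_pos)
    then show ?thesis by (simp add: field_simps)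
  qed
  \<comment> \<open>Two points of the ball have images within 2/10 of each other, hence heights
    differing by less than 1/5. Modulus above 3 at \<open>x\<close> makes
    \<open>2 / ((cmod (h x))\<^sup>2 + 1)\<close> less than 1/5, so the same quantity at
    \<open>y\<close> is less than 2/5, which means modulus above 2.\<close>
  have dich: "cmod (h y) > 2" if "h \<in> F" "x \<in> ball z d" "y \<in> ball z d" "cmod (h x) > 3" for h x y
  proof -
    have "dist (?\<sigma> (h x)) (?\<sigma> (h y)) < 1/5"
      using dist_triangle_half_l[of "?\<sigma> (h x)" "?\<sigma> (h z)" "1/5" "?\<sigma> (h y)"]
        osc[OF that(1,2)] osc[OF that(1,3)] by simp
    then have "snd (?\<sigma> (h x)) - snd (?\<sigma> (h y)) < 1/5"
      using dist_snd_le[of "?\<sigma> (h x)" "?\<sigma> (h y)"] by (simp add: dist_real_def del: stereographic.simps)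
    moreover have "(cmod (h x))\<^sup>2 > 3\<^sup>2" using that(4) by (intro power_strict_mono) auto
    then have "2 / ((cmod (h x))\<^sup>2 + 1) < 1/5" by (simp add: divide_less_eq)
    ultimately have "2 / ((cmod (h y))\<^sup>2 + 1) < 2/5" unfolding height by linarith
    moreover have "(cmod (h y))\<^sup>2 + 1 > 0" by (simp add: add_nonneg_pos)
    ultimately have "(cmod (h y))\<^sup>2 > 2\<^sup>2" by (simp add: field_simps)
    then show ?thesis by (rule power_less_imp_less_base) simp
  qed
  show ?thesis
  proof
    \<comment> \<open>With \<open>a\<close> and \<open>x\<close> within \<open>d / 8\<close> of
      \<open>z\<close>, their distance is at most \<open>d / 4\<close>, half the radius of
      \<open>cball a (d / 2)\<close>. That disc still lies in \<open>ball z d\<close>, so Schottky's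
      theorem applies with \<open>t = 1/2\<close>.\<close>
    show "d / 8 > 0" using d by simp
    fix a M assume a: "a \<in> ball z (d / 8)"
    define B where "B = max 3 (exp (pi * exp (pi * (2 + 2 * M + 12 * (1/2) / (1 - 1/2)))))"
    have "cmod (h x) \<le> B" if "h \<in> F" "cmod (h a) \<le> M" "x \<in> ball z (d / 8)" for h x
    proof (cases "cmod (h x) \<le> 3")
      case True
      then show ?thesis by (simp add: B_def)
    next
      case False
      have x: "x \<in> ball z d" using that d by auto
      have sub: "cball a (d / 2) \<subseteq> ball z d"
      proof
        fix y assume "y \<in> cball a (d / 2)"
        then show "y \<in> ball z d"
          using a d dist_triangle[of z y a] by auto
      qed
      have "cmod (h x) \<le> exp (pi * exp (pi * (2 + 2 * M + 12 * (1/2) / (1 - 1/2))))"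
      proof (rule Schottky_cball[where \<rho> = "d / 2" and a = a and f = h and z = x])
        show "h holomorphic_on cball a (d / 2)"
          using normal that(1) sub d unfolding normal_on_def by (meson holomorphic_on_subset order.trans)
        show "h w \<noteq> 0 \<and> h w \<noteq> 1" if "w \<in> cball a (d / 2)" for w
          using dich[OF \<open>h \<in> F\<close> x, of w] False sub that by force
        have "dist x a \<le> d / 8 + d / 8"
          using a that(3) dist_triangle[of x a z] by (auto simp: dist_commute)
        then show "cmod (x - a) \<le> 1 / 2 * (d / 2)" by (simp add: dist_norm)
      qed (use d that in auto)
      then show ?thesis by (simp add: B_def)
    qed
    then show "\<exists>B. \<forall>h\<in>F. cmod (h a) \<le> M \<longrightarrow> (\<forall>x\<in>ball z (d / 8). cmod (h x) \<le> B)"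
      by blast
  qed
qed

section \<open>Great Picard for transcendental entire functions\<close>

text \<open>By the generalised Liouville theorem \<open>f\<close> coincides with its Taylor
  polynomial at 0 of degree at most \<open>n\<close>.\<close>

lemma entire_polynomially_bounded:
  assumes "f holomorphic_on UNIV" and "\<And>z. A \<le> cmod z \<Longrightarrow> cmod (f z) \<le> B * cmod z ^ n"
  shows "\<exists>p. f = poly p"
proof
  show "f = poly (\<Sum>k\<le>n. monom ((deriv ^^ k) f 0 / fact k) k)"
    using Liouville_polynomial[OF assms] by (auto simp: poly_sum poly_monom)
qed

text \<open>Excluding finite limits of \<open>G\<close> and of its reciprocal rules out a removable
  singularity and a pole, as great Picard requires. The case \<open>n = 0\<close> serves to count
  preimages, \<open>n = 1\<close> to find a fixed point.\<close>

lemma transcendental_entire_essential_singularity: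
  assumes f: "transcendental_entire f" and G: "G = (\<lambda>\<zeta>. \<zeta> ^ n * (f (c + inverse \<zeta>) - b))"
  shows "G holomorphic_on UNIV - {0}" "\<And>l. \<not> (G \<longlongrightarrow> l) (at 0)" "\<And>l. \<not> ((inverse \<circ> G) \<longlongrightarrow> l) (at 0)"
proof -
  have hol: "f holomorphic_on UNIV" using f by (simp add: transcendental_entire_def)
  define g where "g w = f (c + w) - b" for w
  have "(f \<circ> (\<lambda>w. c + w)) holomorphic_on UNIV"
    by (intro holomorphic_on_compose holomorphic_intros holomorphic_on_subset[OF hol]) auto
  then have g: "g holomorphic_on UNIV"
    unfolding g_def[abs_def] by (intro holomorphic_intros) (simp add: comp_def)
  have not_poly: "g \<noteq> poly p" for p
  proof
    assume "g = poly p"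
    then have "f z = poly (pcompose p [:- c, 1:] + [:b:]) z" for z
      by (simp add: poly_pcompose g_def fun_eq_iff) (metis add.commute diff_add_cancel)
    then show False using f unfolding transcendental_entire_def by blast
  qed
  have G_eq: "G = (\<lambda>\<zeta>. \<zeta> ^ n * g (inverse \<zeta>))" by (simp add: G g_def)
  show "G holomorphic_on UNIV - {0}"
    unfolding G_eq
    by (intro holomorphic_intros holomorphic_on_compose_gen[of inverse _ g UNIV, unfolded comp_def] g) auto
  show "\<not> (G \<longlongrightarrow> l) (at 0)" for l
  proof
    assume "(G \<longlongrightarrow> l) (at 0)"
    then have "\<forall>\<^sub>F \<zeta> in at 0. dist (G \<zeta>) l < 1" by (rule tendstoD) simp
    then obtain d where d: "d > 0" "\<And>\<zeta>. \<zeta> \<noteq> 0 \<Longrightarrow> cmod \<zeta> < d \<Longrightarrow> dist (G \<zeta>) l < 1"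
      unfolding eventually_at by (auto simp: dist_norm)
    \<comment> \<open>A finite limit of \<open>G\<close> at 0 bounds \<open>g\<close> near infinity
      by a multiple of \<open>cmod w ^ n\<close>. The threshold \<open>2 / d\<close> ensures
      \<open>cmod (inverse w) < d\<close>.\<close>
    have "cmod (g w) \<le> (cmod l + 1) * cmod w ^ n" if w: "2 / d \<le> cmod w" for w
    proof -
      have w0: "cmod w > 0" using w d by (meson divide_pos_pos less_le_trans zero_less_numeral)
      have "1 < d * cmod w" using w d by (simp add: field_simps)
      then have "cmod (inverse w) < d" using w0 by (simp add: norm_divide field_simps)
      then have "dist (G (inverse w)) l < 1" using w0 d by auto
      then have "cmod (G (inverse w)) \<le> cmod l + 1"
        by (metis add_le_cancel_left dist_norm less_imp_le norm_triangle_sub order.trans)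
      moreover have "cmod (g w) = cmod (G (inverse w)) * cmod w ^ n"
        using w0 by (simp add: G_eq norm_mult norm_power norm_inverse power_inverse)
      ultimately show ?thesis by (simp add: mult_right_mono)
    qed
    then show False using entire_polynomially_bounded[OF g] not_poly by blast
  qed
  show "\<not> ((inverse \<circ> G) \<longlongrightarrow> l) (at 0)" for l
  proof
    assume "((inverse \<circ> G) \<longlongrightarrow> l) (at 0)"
    \<comment> \<open>Multiplying by \<open>\<zeta> ^ n\<close> turns the reciprocal of
      \<open>G\<close> into that of \<open>g\<close> at \<open>inverse \<zeta>\<close>. So the
      reciprocal of \<open>g\<close> converges at infinity, which forces \<open>g\<close> to be a
      polynomial.\<close>
    then have "((\<lambda>\<zeta>. \<zeta> ^ n * inverse (G \<zeta>)) \<longlongrightarrow> 0 ^ n * l) (at 0)"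
      by (intro tendsto_intros) (simp_all add: comp_def)
    moreover have "\<forall>\<^sub>F \<zeta> in at 0. \<zeta> ^ n * inverse (G \<zeta>) = (inverse \<circ> g) (inverse \<zeta>)"
      unfolding eventually_at by (intro exI[of _ 1]) (simp add: G_eq)
    ultimately have "((\<lambda>\<zeta>. (inverse \<circ> g) (inverse \<zeta>)) \<longlongrightarrow> 0 ^ n * l) (at 0)"
      by (rule Lim_transform_eventually)
    then have "((inverse \<circ> g) \<longlongrightarrow> 0 ^ n * l) at_infinity"
      by (simp add: lim_at_infinity_0 comp_def)
    then obtain a m where "\<And>z. g z = (\<Sum>i\<le>m. a i * z^i)"
      using pole_at_infinity[OF g] by metis
    then have "g = poly (\<Sum>k\<le>m. monom (a k) k)" by (auto simp: poly_sum poly_monom)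
    then show False using not_poly by blast
  qed
qed

text \<open>Great Picard at 0 for \<open>\<zeta> \<mapsto> f (inverse \<zeta>)\<close>; inversion
  embeds each fibre of this map into the corresponding fibre of \<open>f\<close>.\<close>

lemma transcendental_entire_infinite_fibres:
  assumes f: "transcendental_entire f"
  obtains a where "\<And>w. w \<noteq> a \<Longrightarrow> infinite {x. f x = w}"
proof -
  define G where "G = (\<lambda>\<zeta>. \<zeta> ^ 0 * (f (0 + inverse \<zeta>) - 0))"
  obtain a where a: "\<And>w. w \<noteq> a \<Longrightarrow> infinite {x. x \<in> UNIV - {0} \<and> G x = w}"
    using great_Picard_infinite[OF open_UNIV UNIV_I transcendental_entire_essential_singularity[OF f G_def]]
    by metis
  have "infinite {x. f x = w}" if "w \<noteq> a" for w
  proof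
    assume "finite {x. f x = w}"
    then have "finite (inverse ` {x. f x = w})" by simp
    moreover have "{x. x \<in> UNIV - {0} \<and> G x = w} \<subseteq> inverse ` {x. f x = w}"
      by (auto simp: G_def image_iff) (metis inverse_inverse_eq)
    ultimately show False using a[OF that] finite_subset by blast
  qed
  then show ?thesis using that by blast
qed

text \<open>With \<open>z = c + inverse \<zeta>\<close>, \<open>G \<zeta>\<close> is
  \<open>(f z - c) / (z - c)\<close>. By hypothesis it omits 0, and great Picard allows only one
  omitted value, so it takes the value 1, which means \<open>f z = z\<close>.\<close>

lemma transcendental_entire_fixpoint:
  assumes f: "transcendental_entire f" and c: "\<And>z. z \<noteq> c \<Longrightarrow> f z \<noteq> c"
  obtains p where "p \<noteq> c" "f p = p"
proof -
  define G where "G = (\<lambda>\<zeta>. \<zeta> ^ 1 * (f (c + inverse \<zeta>) - c))"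
  obtain a where a: "- {a} \<subseteq> G ` (UNIV - {0})"
    using great_Picard_alt[OF open_UNIV UNIV_I transcendental_entire_essential_singularity[OF f G_def]]
    by metis
  have "G \<zeta> \<noteq> 0" if "\<zeta> \<noteq> 0" for \<zeta>
    using that c[of "c + inverse \<zeta>"] by (simp add: G_def)
  then have "0 \<notin> G ` (UNIV - {0})" by (metis DiffE image_iff singletonI)
  then have "a = 0" using a by (metis ComplI singletonD subsetD)
  then have "1 \<in> G ` (UNIV - {0})" using a by (metis ComplI singletonD subsetD zero_neq_one)
  then obtain \<zeta> where "\<zeta> \<noteq> 0" "G \<zeta> = 1" by (metis DiffE imageE singletonI)
  then have "c + inverse \<zeta> \<noteq> c" "f (c + inverse \<zeta>) = c + inverse \<zeta>" by (auto simp: G_def field_simps)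
  then show ?thesis using that by blast
qed

section \<open>Isolated points of the Julia set\<close>

lemma holomorphic_on_funpow:
  assumes "f holomorphic_on UNIV"
  shows "(f ^^ n) holomorphic_on UNIV"
proof (induction n)
  case 0
  then show ?case by (simp add: id_def)
next
  case (Suc n)
  then show ?case
    using holomorphic_on_compose[OF Suc holomorphic_on_subset[OF assms]] by (simp add: comp_def)
qed

lemma transcendental_entire_not_constant_on:
  assumes "transcendental_entire f"
  shows "\<not> f constant_on UNIV"
proof
  assume "f constant_on UNIV"
  then obtain c where "f = poly [:c:]" by (auto simp: constant_on_def fun_eq_iff)
  then show False using assms unfolding transcendental_entire_def by blast
qed

section \<open>Openness and invariance of the Fatou set\<close>

lemma open_Fatou_set: "open (Fatou_set f)"
  by (subst open_subopen) (auto simp: Fatou_set_def)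

text \<open>The open mapping theorem makes the image of a ball around \<open>w\<close> a
  neighbourhood of \<open>f w\<close>. An iterate composed with \<open>f\<close> is the next
  iterate, so convergence near \<open>w\<close> yields convergence near \<open>f w\<close>.\<close>

lemma Fatou_set_forward_invariant:
  assumes f: "transcendental_entire f" and w: "w \<in> Fatou_set f"
  shows "f w \<in> Fatou_set f"
proof -
  let ?F = "{f ^^ n | n. n \<ge> 1}"
  have hol: "f holomorphic_on UNIV" using f by (simp add: transcendental_entire_def)
  obtain U where U: "open U" "w \<in> U" "normal_on U ?F" using w by (auto simp: Fatou_set_def)
  then obtain d where d: "d > 0" "cball w d \<subseteq> U" using open_contains_cball by blast
  have "open (f ` ball w d)"
    by (rule open_mapping_thm[OF hol]) (use transcendental_entire_not_constant_on[OF f] in auto)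
  moreover have "f w \<in> f ` ball w d" using d by simp
  moreover have "normal_on (f ` ball w d) ?F"
    unfolding normal_on_def
  proof (intro conjI ballI allI impI)
    show "h holomorphic_on f ` ball w d" if "h \<in> ?F" for h
      using that holomorphic_on_subset[OF holomorphic_on_funpow[OF hol]] by auto
    fix s :: "nat \<Rightarrow> complex \<Rightarrow> complex" assume s: "range s \<subseteq> ?F"
    have "s k \<circ> f \<in> ?F" for k
    proof -
      obtain n where "s k = f ^^ n" "n \<ge> 1" using s by blast
      then have "s k \<circ> f = f ^^ Suc n" by (simp only: funpow_Suc_right)
      then show ?thesis by (intro CollectI exI[of _ "Suc n"]) simp
    qed
    then have "range (\<lambda>k. s k \<circ> f) \<subseteq> ?F" by blast
    then obtain r :: "nat \<Rightarrow> nat" and g where r: "strict_mono r"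
      and lim: "spherical_uniform_limit (cball w d) ((\<lambda>k. s k \<circ> f) \<circ> r) g"
      using U(3) d compact_cball unfolding normal_on_def by meson
    \<comment> \<open>Since \<open>s (r k) v = s (r k) (f (u v))\<close>, the uniform estimate on
      the closed ball transfers to the image through a choice \<open>u\<close> of preimages.\<close>
    obtain u where u: "\<And>v. v \<in> f ` ball w d \<Longrightarrow> u v \<in> ball w d \<and> f (u v) = v"
      by (metis image_iff)
    have "spherical_uniform_limit K (s \<circ> r) (\<lambda>v. g (u v))" if K: "K \<subseteq> f ` ball w d" for K
      unfolding spherical_uniform_limit_def
    proof (intro allI impI)
      fix e :: real assume "e > 0"
      then have "\<forall>\<^sub>F k in sequentially. \<forall>z\<in>cball w d. spherical_dist (Some (s (r k) (f z))) (g z) < e"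
        using lim unfolding spherical_uniform_limit_def by simp
      then show "\<forall>\<^sub>F k in sequentially. \<forall>v\<in>K. spherical_dist (Some ((s \<circ> r) k v)) (g (u v)) < e"
      proof eventually_elim
        case (elim k)
        show ?case
        proof
          fix v assume "v \<in> K"
          then have "u v \<in> cball w d" "f (u v) = v" using u[of v] K by auto
          then show "spherical_dist (Some ((s \<circ> r) k v)) (g (u v)) < e"
            using elim[THEN bspec, of "u v"] by simp
        qed
      qed
    qed
    then show "\<exists>(r :: nat \<Rightarrow> nat) g. strict_mono r \<and>
        (\<forall>K. compact K \<and> K \<subseteq> f ` ball w d \<longrightarrow> spherical_uniform_limit K (s \<circ> r) g)"
      using r by blast
  qed
  ultimately show ?thesis unfolding Fatou_set_def by blast
qed

lemma Julia_set_funpow_backward_invariant: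
  assumes "transcendental_entire f" and "(f ^^ n) w \<in> Julia_set f"
  shows "w \<in> Julia_set f"
proof (rule ccontr)
  assume "w \<notin> Julia_set f"
  then have "(f ^^ n) w \<in> Fatou_set f"
    by (induction n) (auto simp: Julia_set_def intro: Fatou_set_forward_invariant[OF assms(1)])
  then show False using assms(2) by (simp add: Julia_set_def)
qed

text \<open>If the orbit of \<open>z\<^sub>0\<close> is infinite then it is injective, so a point has at most one preimage in it.\<close>

lemma isolated_in_Julia_set_finite_fibres:
  assumes f: "transcendental_entire f" and z0: "z0 isolated_in Julia_set f" and w: "w \<in> Julia_set f"
  shows "finite {x. f x = w}"
proof -
  define Orb where "Orb = range (\<lambda>n. (f ^^ n) z0)"
  have hol: "f holomorphic_on UNIV" using f by (simp add: transcendental_entire_def)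
  obtain T where T: "open T" "T \<inter> Julia_set f = {z0}" "z0 \<in> Julia_set f"
    using z0 by (auto simp: isolated_in_def)
  obtain \<rho> where \<rho>: "\<rho> > 0" "ball z0 \<rho> \<subseteq> T" using T open_contains_ball by blast
  have omit: "(f ^^ n) z \<noteq> a" if "a \<in> Julia_set f - Orb" "z \<in> ball z0 \<rho>" for a n z
  proof
    assume "(f ^^ n) z = a"
    then have "z \<in> Julia_set f" using Julia_set_funpow_backward_invariant[OF f, of n z] that by auto
    then have "z = z0" using T \<rho> that by auto
    then show False using \<open>(f ^^ n) z = a\<close> that by (auto simp: Orb_def)
  qed
  have "a = b" if "a \<in> Julia_set f - Orb" "b \<in> Julia_set f - Orb" for a b
  proof (rule ccontr)
    assume "a \<noteq> b"
    have "normal_on (ball z0 \<rho>) {f ^^ n | n. n \<ge> 1}"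
    proof (rule normal_on_omitting_two_values[OF \<open>a \<noteq> b\<close>])
      show "h holomorphic_on ball z0 \<rho>" if "h \<in> {f ^^ n | n. n \<ge> 1}" for h
        using that holomorphic_on_subset[OF holomorphic_on_funpow[OF hol]] by auto
    qed (use omit that in auto)
    then have "z0 \<in> Fatou_set f"
      using \<rho> unfolding Fatou_set_def by (auto intro!: exI[of _ "ball z0 \<rho>"])
    then show False using T by (simp add: Julia_set_def)
  qed
  \<comment> \<open>The point \<open>a\<close> is the only Julia point off the orbit, or arbitrary
    if there is none.\<close>
  then obtain a where a: "Julia_set f \<subseteq> insert a Orb" by blast
  have "{x. f x = w} \<subseteq> Julia_set f"
    using Julia_set_funpow_backward_invariant[OF f, of 1] w by auto
  then have sub: "{x. f x = w} \<subseteq> insert a {x \<in> Orb. f x = w}" using a by blast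
  have "finite {x \<in> Orb. f x = w}"
  proof (cases "finite Orb")
    case False
    have inj: "inj (\<lambda>n. (f ^^ n) z0)"
    proof (rule ccontr)
      assume "\<not> ?thesis"
      then obtain m n where "m < n" and mn: "(f ^^ m) z0 = (f ^^ n) z0"
        unfolding inj_def by (metis linorder_neqE_nat)
      \<comment> \<open>One coincidence makes the orbit eventually periodic: when
        \<open>Suc j\<close> reaches \<open>n\<close>, the index returns to \<open>m\<close>. Then
        the first \<open>n\<close> points exhaust the orbit.\<close>
      have "\<exists>j<n. (f ^^ k) z0 = (f ^^ j) z0" for k
      proof (induction k)
        case 0
        then show ?case using \<open>m < n\<close> by (intro exI[of _ 0]) auto
      next
        case (Suc k)
        then obtain j where j: "j < n" "(f ^^ k) z0 = (f ^^ j) z0" by blast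
        then have "(f ^^ Suc k) z0 = (f ^^ Suc j) z0" by simp
        then show ?case using j \<open>m < n\<close> mn by (metis Suc_lessI)
      qed
      then have "Orb \<subseteq> (\<lambda>j. (f ^^ j) z0) ` {..<n}" by (auto simp: Orb_def)
      then show False using False finite_subset by blast
    qed
    have "x = y" if xy: "x \<in> Orb" "f x = w" "y \<in> Orb" "f y = w" for x y
    proof -
      obtain m n where "x = (f ^^ m) z0" "y = (f ^^ n) z0" using xy(1,3) unfolding Orb_def by blast
      then have "(f ^^ Suc m) z0 = (f ^^ Suc n) z0" using xy(2,4) by simp
      then have "Suc m = Suc n" by (rule injD[OF inj])
      then show ?thesis using \<open>x = _\<close> \<open>y = _\<close> by simp
    qed
    then obtain b where "{x \<in> Orb. f x = w} \<subseteq> {b}" by blast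
    then show ?thesis using finite_subset by blast
  qed simp
  then show ?thesis using sub finite_subset by blast
qed

text \<open>The set of points near which all iterates are uniformly bounded is clopen in the connected set
  \<open>- {c}\<close> and contains \<open>p\<close>, so the iterates are bounded on the circle through \<open>p\<close> around \<open>c\<close>;
  the maximum principle then bounds them near \<open>c\<close> as well.\<close>

lemma fixpoint_imp_puncture_in_Fatou_set:
  assumes hol: "f holomorphic_on UNIV" and c: "- {c} \<subseteq> Fatou_set f" and p: "p \<noteq> c" "f p = p"
  shows "c \<in> Fatou_set f"
proof -
  let ?F = "{f ^^ n | n. n \<ge> 1}"
  define A where "A = {z. \<exists>d>0. \<exists>B. \<forall>h\<in>?F. \<forall>x\<in>ball z d. cmod (h x) \<le> B}"
  \<comment> \<open>The radius depends on \<open>z\<close> alone: boundedness of the iterates at any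
    one point of the ball spreads to the whole ball. This gives openness with \<open>a = z\<close>,
    and closedness with \<open>a\<close> near a limit point \<open>z\<close>.\<close>
  have near: "\<exists>d>0. \<forall>a\<in>ball z d. \<forall>M. (\<forall>h\<in>?F. cmod (h a) \<le> M) \<longrightarrow> ball z d \<subseteq> A"
    if z: "z \<in> - {c}" for z
  proof -
    obtain U where U: "normal_on U ?F" "open U" "z \<in> U" using z c by (auto simp: Fatou_set_def)
    obtain d where d: "d > 0"
      and *: "\<And>a M. a \<in> ball z d \<Longrightarrow> \<exists>B. \<forall>h\<in>?F. cmod (h a) \<le> M \<longrightarrow> (\<forall>x\<in>ball z d. cmod (h x) \<le> B)"
      by (rule normal_on_bounded_at_imp_bounded_near[OF U]) blast
    have "ball z d \<subseteq> A" if a: "a \<in> ball z d" and M: "\<forall>h\<in>?F. cmod (h a) \<le> M" for a M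
    proof
      fix y assume "y \<in> ball z d"
      then obtain e where e: "e > 0" "ball y e \<subseteq> ball z d"
        using open_contains_ball open_ball by blast
      obtain B where "\<forall>h\<in>?F. cmod (h a) \<le> M \<longrightarrow> (\<forall>x\<in>ball z d. cmod (h x) \<le> B)"
        using *[OF a] by blast
      then have "\<forall>h\<in>?F. \<forall>x\<in>ball y e. cmod (h x) \<le> B" using M e by blast
      then show "y \<in> A" using e unfolding A_def by blast
    qed
    then show ?thesis using d by blast
  qed
  have A_orbit: "\<exists>M. \<forall>h\<in>?F. cmod (h a) \<le> M" if "a \<in> A" for a
    using that unfolding A_def by (auto intro: centre_in_ball[THEN iffD2])
  have "- {c} \<subseteq> A"
  proof -
    \<comment> \<open>At this stage \<open>c\<close> may or may not lie in \<open>A\<close>, and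
      \<open>near\<close> speaks only of points other than \<open>c\<close>.\<close>
    have "open (A - {c})"
    proof (rule openI)
      fix a assume "a \<in> A - {c}"
      then obtain d where d: "d > 0" "\<forall>b\<in>ball a d. \<forall>M. (\<forall>h\<in>?F. cmod (h b) \<le> M) \<longrightarrow> ball a d \<subseteq> A"
        using near[of a] by blast
      have "a \<in> ball a d" using d(1) by simp
      then have "ball a d \<subseteq> A" using d(2) A_orbit[of a] \<open>a \<in> A - {c}\<close> by blast
      have "open (ball a d - {c})" by (simp add: open_delete)
      then obtain e where "e > 0" "ball a e \<subseteq> ball a d - {c}"
        using \<open>a \<in> ball a d\<close> \<open>a \<in> A - {c}\<close> unfolding open_contains_ball by blast
      then show "\<exists>e>0. ball a e \<subseteq> A - {c}" using \<open>ball a d \<subseteq> A\<close> by blast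
    qed
    then have "openin (top_of_set (- {c})) (A - {c})"
      by (intro open_subset) auto
    moreover have "closedin (top_of_set (- {c})) (A - {c})"
      unfolding closedin_limpt
    proof (intro conjI allI impI)
      fix z assume z: "z islimpt A - {c} \<and> z \<in> - {c}"
      then obtain d where d: "d > 0" "\<forall>a\<in>ball z d. \<forall>M. (\<forall>h\<in>?F. cmod (h a) \<le> M) \<longrightarrow> ball z d \<subseteq> A"
        using near by blast
      obtain a where "a \<in> A" "a \<in> ball z d"
        using z d(1) unfolding islimpt_approachable by (auto simp: dist_commute)
      then have "ball z d \<subseteq> A" using d A_orbit by blast
      then show "z \<in> A - {c}" using d z by auto
    qed auto
    moreover have "A - {c} \<noteq> {}"
    proof -
      have "(f ^^ n) p = p" for n by (induction n) (simp_all add: p)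
      then have "\<forall>h\<in>?F. cmod (h p) \<le> cmod p" by auto
      moreover obtain d where "d > 0"
        "\<forall>a\<in>ball p d. \<forall>M. (\<forall>h\<in>?F. cmod (h a) \<le> M) \<longrightarrow> ball p d \<subseteq> A"
        using near[of p] p by blast
      ultimately have "p \<in> A" by (meson centre_in_ball subsetD)
      then show ?thesis using p by blast
    qed
    moreover have "connected (- {c})" by (rule connected_punctured_universe) simp
    ultimately have "A - {c} = - {c}" unfolding connected_clopen by blast
    then show ?thesis by blast
  qed
  define R where "R = dist c p"
  have R: "R > 0" using p by (simp add: R_def)
  \<comment> \<open>A finite subcover of the circle by such sets turns the local bounds into the
    single bound \<open>M\<close>.\<close>
  define \<C> where "\<C> = {V. open V \<and> (\<exists>B. \<forall>h\<in>?F. \<forall>x\<in>V. cmod (h x) \<le> B)}"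
  have "sphere c R \<subseteq> \<Union>\<C>"
  proof
    fix z assume "z \<in> sphere c R"
    then have "z \<in> A" using R \<open>- {c} \<subseteq> A\<close> by auto
    then obtain d where "d > 0" "ball z d \<in> \<C>" unfolding A_def \<C>_def by blast
    then show "z \<in> \<Union>\<C>" by (meson UnionI centre_in_ball)
  qed
  then obtain \<D> where \<D>: "\<D> \<subseteq> \<C>" "finite \<D>" "sphere c R \<subseteq> \<Union>\<D>"
    by (rule compactE[OF compact_sphere]) (auto simp: \<C>_def)
  have "\<forall>V\<in>\<D>. \<exists>B. \<forall>h\<in>?F. \<forall>x\<in>V. cmod (h x) \<le> B" using \<D>(1) unfolding \<C>_def by blast
  then obtain B where B: "\<forall>V\<in>\<D>. \<forall>h\<in>?F. \<forall>x\<in>V. cmod (h x) \<le> B V" by (rule bchoice[THEN exE])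
  define M where "M = Max (B ` \<D>)"
  have sphere_bound: "cmod (h x) \<le> M" if hx: "h \<in> ?F" "x \<in> sphere c R" for h x
  proof -
    obtain V where V: "V \<in> \<D>" "x \<in> V" using hx(2) \<D>(3) by blast
    then have "cmod (h x) \<le> B V" using B hx(1) by blast
    also have "\<dots> \<le> M" unfolding M_def using \<D>(2) V(1) by (intro Max_ge) auto
    finally show ?thesis .
  qed
  have hF: "h holomorphic_on S" if "h \<in> ?F" for h S
    using that holomorphic_on_subset[OF holomorphic_on_funpow[OF hol]] by auto
  have "cmod (h z) \<le> M" if "h \<in> ?F" "z \<in> ball c R" for h z
    by (rule maximum_modulus_frontier[of h "ball c R"])
      (use that hF sphere_bound R in \<open>auto simp: frontier_def holomorphic_on_imp_continuous_on\<close>)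
  then have "normal_on (ball c R) ?F" by (intro normal_on_bounded hF) auto
  then show ?thesis
    using R unfolding Fatou_set_def by (auto intro!: exI[of _ "ball c R"])
qed

theorem mainTheorem2:
  fixes f :: "complex \<Rightarrow> complex"
  assumes "transcendental_entire f"
  shows "perfect (Julia_set f)"
proof -
  have False if z0: "z0 isolated_in Julia_set f" for z0
  proof -
    have z0J: "z0 \<in> Julia_set f" using z0 by (simp add: isolated_in_def)
    obtain a where "\<And>w. w \<noteq> a \<Longrightarrow> infinite {x. f x = w}"
      using transcendental_entire_infinite_fibres[OF assms] by blast
    \<comment> \<open>A Julia point other than \<open>a\<close> would have a fibre both infinite and
      finite.\<close>
    then have "Julia_set f \<subseteq> {a}"
      using isolated_in_Julia_set_finite_fibres[OF assms z0] by blast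
    then have J: "Julia_set f = {z0}" using z0J by blast
    \<comment> \<open>By backward invariance a preimage of \<open>z0\<close> lies in the Julia set,
      which is now \<open>{z0}\<close>.\<close>
    have "f z \<noteq> z0" if "z \<noteq> z0" for z
      using Julia_set_funpow_backward_invariant[OF assms, of 1 z] J that by auto
    then obtain p where "p \<noteq> z0" "f p = p"
      using transcendental_entire_fixpoint[OF assms] by metis
    moreover have "- {z0} \<subseteq> Fatou_set f" using J by (auto simp: Julia_set_def)
    ultimately have "z0 \<in> Fatou_set f"
      using fixpoint_imp_puncture_in_Fatou_set[of f z0 p] assms by (simp add: transcendental_entire_def)
    then show False using z0J by (simp add: Julia_set_def)
  qed
  then show ?thesis
    using open_Fatou_set by (auto simp: perfect_def Julia_set_def closed_def)
qed

end
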